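(* Any order-oblivious online algorithm for the secretary problem has a competitive-ratio of at most $\frac14\left(1+\frac{5}{n-1}\right)=\frac14+o(1)$, where $n\ge 2$ is the size of the online sequence. That is, for every $n\ge2$, if an order-oblivious algorithm is order-oblivious $c$-competitive on all inputs with $n$ elements, then $c\le\frac14\left(1+\frac5{n-1}\right)$.
   Context: Secretary problem: an adversary chooses $n$ elements with non-negative real values; they arrive online one by one, the value of each being revealed on arrival, and the algorithm (which knows $n$) may irrevocably accept at most one element, at the time it arrives. $\mathrm{OPT}$ is the maximum value, and $\mathrm{ALG}$ is the value of the accepted element ($0$ if none). An order-oblivious algorithm is a (possibly randomized) algorithm that sets a (possibly random) integer $k$, $0\le k\le n$, collects the first $k$ elements of the sequence into a sample without accepting any of them (sampling phase), and then makes accept/reject decisions on the later arriving elements based on the values observed so far. It is order-oblivious $c$-competitive if $\mathrm{E}[\mathrm{ALG}]\ge c\cdot\mathrm{OPT}$ on every input, where the sample consists of the first $k$ elements of a uniformly random permutation of the input, and the inequality holds for any (possibly adversarial, sample-dependent) arrival order of the remaining $n-k$ elements. The expectation is over the random sample and the algorithm's internal randomness. *)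

theory Defs
  imports
    "HOL-Probability.Probability"
    "HOL-Combinatorics.Multiset_Permutations"
    "HOL-Library.Landau_Symbols"
begin

text \<open>
  The points of \<open>M\<close> are the outcomes of the internal randomness. Both the sample size and the
  decisions are functions of the outcome, so they may be correlated in an arbitrary way.
  The decision \<open>accept \<omega> h\<close> concerns the last entry of the list \<open>h\<close> of all values observed so far
  (sample included, in order of arrival). Since \<open>n\<close> is fixed, the algorithm may depend on it.
\<close>

locale order_oblivious_algorithm = prob_space M
  for M :: "'w measure" and n :: nat
    and sample_size :: "'w \<Rightarrow> nat" and accept :: "'w \<Rightarrow> real list \<Rightarrow> bool" +
  assumes sample_size_measurable: "sample_size \<in> M \<rightarrow>\<^sub>M count_space UNIV"
    and accept_measurable: "\<And>h. Measurable.pred M (\<lambda>\<omega>. accept \<omega> h)"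
    and sample_size_le: "\<And>\<omega>. \<omega> \<in> space M \<Longrightarrow> sample_size \<omega> \<le> n"

text \<open>
  The value obtained on the sequence \<open>xs\<close> with the first \<open>k\<close> entries as sample: the first entry
  after the sample that the decision rule \<open>acc\<close> accepts, and \<open>0\<close> if there is none.
\<close>

definition accepted_value :: "nat \<Rightarrow> (real list \<Rightarrow> bool) \<Rightarrow> real list \<Rightarrow> real" where
  "accepted_value k acc xs =
    (if \<exists>i. k \<le> i \<and> i < length xs \<and> acc (take (Suc i) xs)
     then xs ! (LEAST i. k \<le> i \<and> i < length xs \<and> acc (take (Suc i) xs))
     else 0)"

text \<open>
  An adversarial order assigns to each set \<open>S\<close> of sampled elements an order of the remaining
  ones. The adversary knows the sample (hence also its size), but neither the rest of the internal
  randomness nor the order in which the sampled elements were seen.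
\<close>

definition adversarial_order :: "nat \<Rightarrow> (nat set \<Rightarrow> nat list) \<Rightarrow> bool" where
  "adversarial_order n ord \<longleftrightarrow> (\<forall>S\<subseteq>{..<n}. ord S \<in> permutations_of_set ({..<n} - S))"

definition arrival_sequence :: "nat \<Rightarrow> (nat set \<Rightarrow> nat list) \<Rightarrow> nat list \<Rightarrow> nat list" where
  "arrival_sequence k ord p = take k p @ ord (set (take k p))"

definition expected_ALG ::
  "'w measure \<Rightarrow> nat \<Rightarrow> ('w \<Rightarrow> nat) \<Rightarrow> ('w \<Rightarrow> real list \<Rightarrow> bool)
    \<Rightarrow> (nat \<Rightarrow> real) \<Rightarrow> (nat set \<Rightarrow> nat list) \<Rightarrow> real" where
  "expected_ALG M n sample_size accept v ord =
    measure_pmf.expectation (pmf_of_set (permutations_of_set {..<n}))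
      (\<lambda>p. \<integral>\<omega>. accepted_value (sample_size \<omega>) (accept \<omega>)
                 (map v (arrival_sequence (sample_size \<omega>) ord p)) \<partial>M)"

definition OPT :: "nat \<Rightarrow> (nat \<Rightarrow> real) \<Rightarrow> real" where
  "OPT n v = Max (v ` {..<n})"

definition order_oblivious_competitive ::
  "'w measure \<Rightarrow> nat \<Rightarrow> ('w \<Rightarrow> nat) \<Rightarrow> ('w \<Rightarrow> real list \<Rightarrow> bool) \<Rightarrow> real \<Rightarrow> bool" where
  "order_oblivious_competitive M n sample_size accept c \<longleftrightarrow>
    (\<forall>v ord. (\<forall>i<n. v i \<ge> 0) \<longrightarrow> adversarial_order n ord \<longrightarrow>
      expected_ALG M n sample_size accept v ord \<ge> c * OPT n v)"

end

theory Submission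
  imports Defs "HOL-Library.Ramsey" "HOL-Real_Asymp.Real_Asymp"
begin

text \<open>
  Let the remaining elements that beat the whole sample arrive first, in increasing order. If \<open>J\<close> of
  them exist, then at the \<open>j\<close>-th one an algorithm that only compares values cannot tell whether
  \<open>j = J\<close>. So it wins with probability at most \<open>max\<^sub>j P(J = j)\<close>, which for \<open>k \<ge> 1\<close> is attained at
  \<open>j = 1\<close> and equals \<open>k (n - k) / (n (n - 1)) \<le> n / (4 (n - 1))\<close>. For \<open>k = 0\<close> the adversary lets the
  top \<open>t\<close> elements arrive first, in increasing order, and averaging over \<open>t = 1, \<dots>, n\<close> leaves a
  winning probability of at most \<open>1 / n\<close>.

  Ramsey's theorem reduces arbitrary algorithms to this case: on an infinite set of powers of a
  large base, the relevant acceptance probabilities depend, up to a small error, only on the sample size and the number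
  of values seen. The large base makes every element other than the maximum worthless.
\<close>

section \<open>Approximate homogeneity by Ramsey's theorem\<close>

text \<open>Rounding the values of \<open>f i\<close> down to multiples of \<delta> colours the sets
  of size \<open>r i\<close> with finitely many colours, and sets of equal colour have values less
  than \<delta> apart. Finitely many indices can be treated one after another because the property
  passes to subsets of \<open>V\<close>.\<close>

lemma infinite_subset_small_oscillation:
  fixes f :: "'i \<Rightarrow> 'a set \<Rightarrow> real"
  assumes "finite I" "infinite Z" "\<delta> > 0"
    and bound: "\<And>i X. i \<in> I \<Longrightarrow> f i X \<in> {0..1}"
  shows "\<exists>V\<subseteq>Z. infinite V \<and> (\<forall>i\<in>I. \<forall>X\<subseteq>V. \<forall>Y\<subseteq>V.
           finite X \<longrightarrow> finite Y \<longrightarrow> card X = r i \<longrightarrow> card Y = r i \<longrightarrow> f i X \<le> f i Y + \<delta>)"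
  using assms(1) bound
proof (induction I rule: finite_induct)
  case empty
  then show ?case using \<open>infinite Z\<close> by auto
next
  case (insert i I)
  then obtain V where V: "V \<subseteq> Z" "infinite V"
    and osc: "\<And>j X Y. \<lbrakk>j \<in> I; X \<subseteq> V; Y \<subseteq> V; finite X; finite Y; card X = r j; card Y = r j\<rbrakk>
           \<Longrightarrow> f j X \<le> f j Y + \<delta>"
    by (smt (verit) insertCI)
  define col where "col X = nat \<lfloor>f i X / \<delta>\<rfloor>" for X
  have fi: "0 \<le> f i X" "f i X \<le> 1" for X
    using insert.prems[of i X] by auto
  have "col X < Suc (nat \<lfloor>1 / \<delta>\<rfloor>)" for X
    unfolding col_def less_Suc_eq_le
    using fi[of X] \<open>\<delta> > 0\<close> by (intro nat_mono floor_mono divide_right_mono) auto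
  with Ramsey[OF V(2), of "r i" col] obtain W t where W: "W \<subseteq> V" "infinite W"
    and col: "\<And>X. \<lbrakk>X \<subseteq> W; finite X; card X = r i\<rbrakk> \<Longrightarrow> col X = t"
    by metis
  have osc_i: "f i X \<le> f i Y + \<delta>"
    if "X \<subseteq> W" "Y \<subseteq> W" "finite X" "finite Y" "card X = r i" "card Y = r i" for X Y
  proof -
    have "0 \<le> f i X / \<delta>" "0 \<le> f i Y / \<delta>"
      using fi \<open>\<delta> > 0\<close> by auto
    moreover have "col X = col Y"
      using that col by simp
    \<comment> \<open>Truncation by \<open>nat\<close> loses nothing, as both quotients are
      non-negative.\<close>
    ultimately have "\<lfloor>f i X / \<delta>\<rfloor> = \<lfloor>f i Y / \<delta>\<rfloor>"
      unfolding col_def by (simp add: eq_nat_nat_iff)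
    then have "f i X / \<delta> \<le> f i Y / \<delta> + 1"
      by linarith
    then show ?thesis
      using \<open>\<delta> > 0\<close> by (simp add: field_simps)
  qed
  have "\<forall>j\<in>insert i I. \<forall>X\<subseteq>W. \<forall>Y\<subseteq>W.
           finite X \<longrightarrow> finite Y \<longrightarrow> card X = r j \<longrightarrow> card Y = r j \<longrightarrow> f j X \<le> f j Y + \<delta>"
  proof (intro ballI allI impI)
    fix j X Y
    assume *: "j \<in> insert i I" "X \<subseteq> W" "Y \<subseteq> W" "finite X" "finite Y" "card X = r j" "card Y = r j"
    show "f j X \<le> f j Y + \<delta>"
    proof (cases "j = i")
      case True
      then show ?thesis using * osc_i by simp
    next
      case False
      then show ?thesis using * W(1) by (intro osc) auto
    qed
  qed
  then show ?case
    using V W by (intro exI[of _ W]) auto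
qed

section \<open>Prefixes of a uniformly random permutation\<close>

text \<open>Cutting after position \<open>k\<close> is a bijection from the permutations with sample
  set \<open>S\<close> to pairs of an ordering of \<open>S\<close> and an ordering of
  \<open>A - S\<close>. Hence the sample is a uniformly random \<open>k\<close>-subset, seen in a
  uniformly random order.\<close>

lemma sum_permutations_take:
  fixes F :: "'a list \<Rightarrow> real"
  assumes "finite A" "k \<le> card A"
  shows "(\<Sum>p\<in>permutations_of_set A. F (take k p)) / fact (card A) =
         (\<Sum>S | S \<subseteq> A \<and> card S = k. (\<Sum>xs\<in>permutations_of_set S. F xs) / fact k)
           / real (card A choose k)"
proof -
  let ?P = "permutations_of_set" and ?T = "{S. S \<subseteq> A \<and> card S = k}"
  have finT: "finite ?T" using assms by auto
  have fib: "(\<Sum>p | p \<in> ?P A \<and> set (take k p) = S. F (take k p)) =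
             fact (card A - k) * (\<Sum>xs\<in>?P S. F xs)" if "S \<in> ?T" for S
  proof -
    have S: "S \<subseteq> A" "card S = k" "finite S" using that assms finite_subset by auto
    have "(\<Sum>p | p \<in> ?P A \<and> set (take k p) = S. F (take k p)) =
          (\<Sum>(xs, ys) \<in> ?P S \<times> ?P (A - S). F xs)"
    proof (rule sum.reindex_bij_witness[where j = "\<lambda>p. (take k p, drop k p)"
                                          and i = "\<lambda>(xs, ys). xs @ ys"], goal_cases)
      case (2 p)
      then have p: "set p = A" "distinct p" "set (take k p) = S"
        by (auto dest: permutations_of_setD)
      have "set p = set (take k p) \<union> set (drop k p)"
        by (metis append_take_drop_id set_append)
      moreover have "set (take k p) \<inter> set (drop k p) = {}"
        using p(2) by (metis append_take_drop_id distinct_append)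
      ultimately show ?case
        using p by (auto intro!: permutations_of_setI)
    next
      case (4 b)
      then obtain xs ys where b: "b = (xs, ys)" "xs \<in> ?P S" "ys \<in> ?P (A - S)"
        by auto
      note b = b(1) b(2,3)[THEN permutations_of_setD(1)] b(2,3)[THEN permutations_of_setD(2)]
      then have "length xs = k" using S distinct_card by fastforce
      then show ?case using b S by (auto intro!: permutations_of_setI)
    next
      case (3 b)
      then obtain xs ys where b: "b = (xs, ys)" "xs \<in> ?P S" "ys \<in> ?P (A - S)"
        by auto
      note b = b(1) b(2,3)[THEN permutations_of_setD(1)] b(2,3)[THEN permutations_of_setD(2)]
      then have "length xs = k" using S distinct_card by fastforce
      then show ?case using b by auto
    qed auto
    also have "\<dots> = (\<Sum>xs\<in>?P S. \<Sum>ys\<in>?P (A - S). F xs)"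
      by (rule sum.cartesian_product[symmetric])
    also have "\<dots> = fact (card A - k) * (\<Sum>xs\<in>?P S. F xs)"
      using S assms by (simp add: card_Diff_subset sum_distrib_left)
    finally show ?thesis .
  qed
  have "(\<Sum>p\<in>?P A. F (take k p)) = (\<Sum>S\<in>?T. \<Sum>p | p \<in> ?P A \<and> set (take k p) = S. F (take k p))"
  proof (rule sum.group[symmetric])
    show "(\<lambda>p. set (take k p)) ` ?P A \<subseteq> ?T"
    proof clarsimp
      fix p assume "p \<in> ?P A"
      then have p: "set p = A" "distinct p" by (auto dest: permutations_of_setD)
      then have "card (set (take k p)) = length (take k p)"
        by (intro distinct_card) auto
      moreover have "length p = card A" using p distinct_card by fastforce
      ultimately show "set (take k p) \<subseteq> A \<and> card (set (take k p)) = k"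
        using p assms by (auto dest: in_set_takeD)
    qed
  qed (use finT in auto)
  also have "\<dots> = (\<Sum>S\<in>?T. fact (card A - k) * (\<Sum>xs\<in>?P S. F xs))"
    using fib by (intro sum.cong) auto
  also have "\<dots> / fact (card A) =
      (\<Sum>S\<in>?T. (\<Sum>xs\<in>?P S. F xs) / fact k) / real (card A choose k)"
    using assms(2)
    by (simp add: binomial_fact sum_divide_distrib[symmetric] sum_distrib_left[symmetric])
  finally show ?thesis .
qed

section \<open>First acceptance at the end of a history\<close>

text \<open>The event that the first acceptance after the sample falls on the last entry of
  \<open>h\<close>. Positions are replaced by prefix lengths, which exceed them by one; hence
  \<open>k < i\<close> where \<open>accepted_value\<close> has \<open>k \<le> i\<close>.\<close>

definition stops_at :: "nat \<Rightarrow> (real list \<Rightarrow> bool) \<Rightarrow> real list \<Rightarrow> bool" where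
  "stops_at k acc h \<longleftrightarrow> k < length h \<and> acc h \<and> (\<forall>i. k < i \<and> i < length h \<longrightarrow> \<not> acc (take i h))"

text \<open>Here \<open>m\<close> is the only element worth more than \<open>u\<close>. Unless it
  lies in the sample \<open>xs\<close>, it can only be the last entry of \<open>ys\<close>, so
  taking it means stopping exactly at the end of \<open>xs @ ys\<close>; any other choice earns at
  most \<open>u\<close>.\<close>

lemma accepted_value_le:
  assumes "distinct (xs @ ys @ zs)" "m \<notin> set zs" "ys \<noteq> [] \<Longrightarrow> last ys = m"
    and b: "v m \<le> b" and u: "0 \<le> u" "\<And>x. x \<in> set (ys @ zs) \<Longrightarrow> x \<noteq> m \<Longrightarrow> v x \<le> u"
    and nonneg: "0 \<le> b"
  shows "accepted_value (length xs) acc (map v (xs @ ys @ zs))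
           \<le> b * of_bool (stops_at (length xs) acc (map v (xs @ ys))) + u"
proof -
  let ?L = "xs @ ys @ zs"
  let ?acc = "\<lambda>i. length xs \<le> i \<and> i < length (map v ?L) \<and> acc (take (Suc i) (map v ?L))"
  define i where "i = (LEAST i. ?acc i)"
  show ?thesis
  proof (cases "\<exists>i. ?acc i")
    case False
    then show ?thesis
      unfolding accepted_value_def if_not_P[OF False] using u nonneg by simp
  next
    case True
    have i: "?acc i"
      unfolding i_def by (rule LeastI_ex[OF True])
    have least: "i \<le> j" if "?acc j" for j
      unfolding i_def by (rule Least_le[of ?acc, OF that])
    have val: "accepted_value (length xs) acc (map v ?L) = v (?L ! i)"
      unfolding accepted_value_def if_P[OF True] i_def[symmetric] using i by (subst nth_map) auto
    have "?L ! i = (ys @ zs) ! (i - length xs)"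
      using i by (simp add: nth_append)
    then have mem: "?L ! i \<in> set (ys @ zs)"
      using i by (metis add_diff_inverse_nat length_append length_map nat_add_left_cancel_less not_less nth_mem)
    show ?thesis
    proof (cases "?L ! i = m")
      case False
      then have "v (?L ! i) \<le> u" using u mem by blast
      then show ?thesis unfolding val using nonneg by (simp add: add_increasing)
    next
      case True
      then have "m \<in> set ys" using mem assms by auto
      then have "ys \<noteq> []" by auto
      then have "?L ! (length (xs @ ys) - 1) = m"
        using assms(3) \<open>ys \<noteq> []\<close> by (cases ys rule: rev_cases) (auto simp: nth_append)
      \<comment> \<open>By distinctness, \<open>m\<close> occurs at one position only.\<close>
      then have i_eq: "i = length (xs @ ys) - 1"
        using True i assms(1) \<open>ys \<noteq> []\<close>
        by (metis (no_types, lifting) append_assoc diff_less length_append length_greater_0_conv length_map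
            less_numeral_extra(1) nth_eq_iff_index_eq Nil_is_append_conv trans_less_add1)
      have tk: "take (Suc i) (map v ?L) = map v (xs @ ys)"
        unfolding i_eq using \<open>ys \<noteq> []\<close> by (cases "length ys") auto
      have "stops_at (length xs) acc (map v (xs @ ys))"
        unfolding stops_at_def
      proof (intro conjI allI impI)
        show "length xs < length (map v (xs @ ys))" using \<open>ys \<noteq> []\<close> by simp
        show "acc (map v (xs @ ys))" using i unfolding tk by blast
        fix j assume j: "length xs < j \<and> j < length (map v (xs @ ys))"
        show "\<not> acc (take j (map v (xs @ ys)))"
        proof
          assume "acc (take j (map v (xs @ ys)))"
          moreover have "take j (map v (xs @ ys)) = take (Suc (j - 1)) (map v ?L)"
            using j by (cases j) auto
          ultimately have "?acc (j - 1)" using j by auto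
          from least[OF this] show False using j i_eq by auto
        qed
      qed
      then show ?thesis unfolding val True using b u by simp
    qed
  qed
qed

lemma sorted_list_of_set_Un_less:
  fixes S A :: "'a::linorder set"
  assumes "finite S" "finite A" "\<And>s a. s \<in> S \<Longrightarrow> a \<in> A \<Longrightarrow> s < a"
  shows "sorted_list_of_set (S \<union> A) = sorted_list_of_set S @ sorted_list_of_set A"
  by (rule sorted_distinct_set_unique) (use assms in \<open>auto simp: sorted_append less_imp_le\<close>)

lemma sorted_list_of_set_strict_mono_image:
  fixes e :: "'a::linorder \<Rightarrow> 'b::linorder"
  assumes "strict_mono e"
  shows "sorted_list_of_set (e ` H) = map e (sorted_list_of_set H)"
proof (cases "finite H")
  case True
  have "inj e" using assms by (rule strict_mono_imp_inj_on)
  then show ?thesis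
    using True assms
    by (intro sorted_distinct_set_unique)
       (auto simp: sorted_map strict_mono_less_eq distinct_map intro: inj_on_subset)
next
  case False
  then have "infinite (e ` H)"
    using assms by (meson finite_imageD inj_on_subset strict_mono_imp_inj_on subset_UNIV)
  then show ?thesis using False by simp
qed

section \<open>Stopping probabilities\<close>

context order_oblivious_algorithm
begin

definition size_prob :: "nat \<Rightarrow> real" where
  "size_prob k = prob {\<omega> \<in> space M. sample_size \<omega> = k}"

text \<open>A joint rather than a conditional probability: sample size and decisions may be
  correlated, and for fixed \<open>k\<close> disjoint stopping events then add up to at most
  \<open>size_prob k\<close>.\<close>

definition stop_prob :: "nat \<Rightarrow> real list \<Rightarrow> real" where
  "stop_prob k h = prob {\<omega> \<in> space M. sample_size \<omega> = k \<and> stops_at k (accept \<omega>) h}"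

text \<open>
  The history consists of the \<open>k\<close> lowest elements of \<open>H\<close> as sample, in random order, followed by
  the others in increasing order. Averaging over the order of the sample turns the stopping
  probability into a function of a set, to which Ramsey's theorem applies.
\<close>

definition mean_stop_prob :: "(nat \<Rightarrow> real) \<Rightarrow> nat \<Rightarrow> nat set \<Rightarrow> real" where
  "mean_stop_prob v k H =
    (let L = sorted_list_of_set H
     in (\<Sum>xs\<in>permutations_of_set (set (take k L)). stop_prob k (map v (xs @ drop k L))) / fact k)"

lemma size_event: "{\<omega> \<in> space M. sample_size \<omega> = k} \<in> events"
  using sample_size_measurable by measurable

lemma stop_event: "{\<omega> \<in> space M. sample_size \<omega> = k \<and> stops_at k (accept \<omega>) h} \<in> events"
proof -
  note [measurable] = sample_size_measurable accept_measurable
  show ?thesis unfolding stops_at_def by measurable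
qed

lemma sum_size_prob: "(\<Sum>k\<le>n. size_prob k) = 1"
proof -
  have "(\<Sum>k\<le>n. size_prob k) = prob (\<Union>k\<in>{..n}. {\<omega> \<in> space M. sample_size \<omega> = k})"
    unfolding size_prob_def
    by (rule finite_measure_finite_Union[symmetric])
       (use size_event in \<open>auto simp: disjoint_family_on_def\<close>)
  also have "(\<Union>k\<in>{..n}. {\<omega> \<in> space M. sample_size \<omega> = k}) = space M"
    using sample_size_le by auto
  finally show ?thesis by (simp add: prob_space)
qed

lemma stop_prob_nonneg: "0 \<le> stop_prob k h"
  and stop_prob_le_1: "stop_prob k h \<le> 1"
  unfolding stop_prob_def by auto

lemma stop_prob_sample: "length h \<le> k \<Longrightarrow> stop_prob k h = 0"
  unfolding stop_prob_def stops_at_def by simp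

text \<open>The first acceptance along a fixed sequence happens at only one prefix, so these are
  disjoint parts of the event that the sample has size \<open>k\<close>.\<close>

lemma sum_stop_prob_take_le:
  assumes "finite J" "J \<subseteq> {..length L}"
  shows "(\<Sum>j\<in>J. stop_prob k (take j L)) \<le> size_prob k"
proof -
  let ?E = "\<lambda>j. {\<omega> \<in> space M. sample_size \<omega> = k \<and> stops_at k (accept \<omega>) (take j L)}"
  have excl: "\<not> (stops_at k acc (take i L) \<and> stops_at k acc (take j L))"
    if "i < j" "j \<le> length L" for acc i j
    using that unfolding stops_at_def by (auto simp: min_def dest!: spec[where x = i])
  have "disjoint_family_on ?E J"
    unfolding disjoint_family_on_def
  proof (intro ballI impI)
    fix i j assume "i \<in> J" "j \<in> J" "i \<noteq> j"
    then have "i < j \<and> j \<le> length L \<or> j < i \<and> i \<le> length L"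
      using assms by fastforce
    then show "?E i \<inter> ?E j = {}"
      using excl by blast
  qed
  then have "(\<Sum>j\<in>J. stop_prob k (take j L)) = prob (\<Union>j\<in>J. ?E j)"
    unfolding stop_prob_def
    by (intro finite_measure_finite_Union[symmetric]) (use stop_event assms in auto)
  also have "\<dots> \<le> size_prob k"
    unfolding size_prob_def by (rule finite_measure_mono) (use size_event in auto)
  finally show ?thesis .
qed

lemma mean_stop_prob_bounds: "mean_stop_prob v k H \<in> {0..1}"
proof -
  define L where "L = sorted_list_of_set H"
  let ?S = "set (take k L)"
  \<comment> \<open>Fewer than \<open>k\<close> elements are possible: \<open>H\<close> may be too
    small, or infinite, when its sorted list is empty by convention.\<close>
  have "card ?S \<le> k"
    using card_length[of "take k L"] by simp
  then have "fact (card ?S) \<le> (fact k :: real)"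
    by (rule fact_mono)
  moreover have "(\<Sum>xs\<in>permutations_of_set ?S. stop_prob k (map v (xs @ drop k L)))
      \<le> (\<Sum>xs\<in>permutations_of_set ?S. 1)"
    by (intro sum_mono stop_prob_le_1)
  ultimately have "(\<Sum>xs\<in>permutations_of_set ?S. stop_prob k (map v (xs @ drop k L))) \<le> fact k"
    by simp
  then show ?thesis
    unfolding mean_stop_prob_def L_def[symmetric] Let_def
    by (auto intro!: divide_nonneg_nonneg sum_nonneg stop_prob_nonneg)
qed

text \<open>The \<open>k\<close> lowest elements of the union are exactly those of \<open>S\<close>,
  so the split inside \<open>mean_stop_prob\<close> recovers the sample and the increasing run after
  it.\<close>

lemma mean_stop_prob_Un:
  assumes "finite S" "finite A" "\<And>s a. s \<in> S \<Longrightarrow> a \<in> A \<Longrightarrow> s < a" "card S = k"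
  shows "mean_stop_prob v k (S \<union> A) =
    (\<Sum>xs\<in>permutations_of_set S. stop_prob k (map v (xs @ sorted_list_of_set A))) / fact k"
  using assms(4) by (simp add: mean_stop_prob_def sorted_list_of_set_Un_less[OF assms(1-3)] assms(1))

text \<open>An increasing renumbering commutes with sorting. This moves the infinite set found by
  Ramsey's theorem back to all natural numbers.\<close>

lemma mean_stop_prob_image:
  assumes "strict_mono e"
  shows "mean_stop_prob v k (e ` H) = mean_stop_prob (v \<circ> e) k H"
proof -
  have inj: "inj_on e X" for X
    using assms by (meson inj_on_subset strict_mono_imp_inj_on subset_UNIV)
  have inj': "inj_on (map e) X" for X
    using inj by (meson inj_on_subset inj_mapI subset_UNIV)
  show ?thesis
    unfolding mean_stop_prob_def sorted_list_of_set_strict_mono_image[OF assms] Let_def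
    by (simp add: take_map drop_map permutations_of_set_image_inj[OF inj] sum.reindex[OF inj'])
qed

text \<open>For each ordering \<open>xs\<close> of the \<open>k\<close> lowest elements, the
  histories belonging to the initial segments are prefixes of the single sequence
  \<open>xs @ [k..<m]\<close>. Their stopping events are therefore disjoint; the average over
  \<open>xs\<close> keeps the bound.\<close>

lemma sum_mean_stop_prob_le:
  assumes "k \<le> m"
  shows "(\<Sum>j\<le>m - k. mean_stop_prob v k {..<k + j}) \<le> size_prob k"
proof -
  let ?P = "permutations_of_set {..<k}"
  have eq: "mean_stop_prob v k {..<k + j} =
      (\<Sum>xs\<in>?P. stop_prob k (take (k + j) (map v (xs @ [k..<m])))) / fact k" if "j \<le> m - k" for j
  proof -
    have "{..<k + j} = {..<k} \<union> {k..<k + j}" by auto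
    then have "mean_stop_prob v k {..<k + j} =
      (\<Sum>xs\<in>?P. stop_prob k (map v (xs @ [k..<k + j]))) / fact k"
      using mean_stop_prob_Un[of "{..<k}" "{k..<k + j}" k v] by simp
    also have "(\<Sum>xs\<in>?P. stop_prob k (map v (xs @ [k..<k + j]))) =
        (\<Sum>xs\<in>?P. stop_prob k (take (k + j) (map v (xs @ [k..<m]))))"
    proof (rule sum.cong)
      fix xs assume "xs \<in> ?P"
      then have "length xs = k" by (simp add: length_finite_permutations_of_set)
      then have "take (k + j) (map v (xs @ [k..<m])) = map v (xs @ [k..<k + j])"
        using that assms by (simp add: take_map)
      then show "stop_prob k (map v (xs @ [k..<k + j])) =
          stop_prob k (take (k + j) (map v (xs @ [k..<m])))" by simp
    qed simp
    finally show ?thesis .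
  qed
  have "(\<Sum>j\<le>m - k. mean_stop_prob v k {..<k + j}) =
      (\<Sum>xs\<in>?P. \<Sum>j\<le>m - k. stop_prob k (take (k + j) (map v (xs @ [k..<m])))) / fact k"
    by (subst sum.swap) (simp add: eq sum_divide_distrib)
  also have "\<dots> \<le> (\<Sum>xs\<in>?P. size_prob k) / fact k"
  proof (intro divide_right_mono sum_mono)
    fix xs assume "xs \<in> ?P"
    then have "length xs = k" by (simp add: length_finite_permutations_of_set)
    then have "(\<Sum>i\<in>(+) k ` {..m - k}. stop_prob k (take i (map v (xs @ [k..<m])))) \<le> size_prob k"
      using assms by (intro sum_stop_prob_take_le) auto
    then show "(\<Sum>j\<le>m - k. stop_prob k (take (k + j) (map v (xs @ [k..<m])))) \<le> size_prob k"
      by (simp add: sum.reindex)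
  qed simp
  also have "\<dots> = size_prob k" by simp
  finally show ?thesis .
qed

section \<open>Values that hide everything but their relative order\<close>

text \<open>Ramsey's theorem selects the exponents of powers of \<open>B\<close>, and enumerating
  them increasingly gives the values. Distinct exponents differ by at least one, which yields the
  factor \<open>B\<close>.\<close>

lemma exists_indistinguishable_values:
  fixes B \<delta> :: real
  assumes "1 \<le> B" "0 < \<delta>"
  shows "\<exists>v :: nat \<Rightarrow> real. (\<forall>i. 0 < v i) \<and> (\<forall>i j. i < j \<longrightarrow> B * v i \<le> v j) \<and>
    (\<forall>k\<le>n. \<forall>X\<subseteq>{..<n}. \<forall>Y\<subseteq>{..<n}. card X = card Y \<longrightarrow>
       mean_stop_prob v k X \<le> mean_stop_prob v k Y + \<delta>)"
proof -
  define w where "w i = B ^ i" for i :: nat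
  \<comment> \<open>An index is a pair of a sample size and a cardinality of the set of values
    seen.\<close>
  have "\<exists>V\<subseteq>UNIV. infinite V \<and> (\<forall>i\<in>{..n} \<times> {..n}. \<forall>X\<subseteq>V. \<forall>Y\<subseteq>V.
      finite X \<longrightarrow> finite Y \<longrightarrow> card X = snd i \<longrightarrow> card Y = snd i \<longrightarrow>
      mean_stop_prob w (fst i) X \<le> mean_stop_prob w (fst i) Y + \<delta>)"
    by (rule infinite_subset_small_oscillation) (use assms mean_stop_prob_bounds in auto)
  then obtain V where V: "infinite V"
    and osc: "\<And>k l X Y. \<lbrakk>k \<le> n; l \<le> n; X \<subseteq> V; Y \<subseteq> V; finite X; finite Y; card X = l; card Y = l\<rbrakk>
       \<Longrightarrow> mean_stop_prob w k X \<le> mean_stop_prob w k Y + \<delta>"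
    by fastforce
  define e where "e = enumerate V"
  have e: "strict_mono e"
    unfolding e_def using V by (simp add: strict_mono_enumerate)
  have eV: "e ` X \<subseteq> V" for X
    unfolding e_def using V by (auto simp: enumerate_in_set)
  show ?thesis
  proof (intro exI[of _ "w \<circ> e"] conjI allI impI)
    show "0 < (w \<circ> e) i" for i using assms by (simp add: w_def)
    show "B * (w \<circ> e) i \<le> (w \<circ> e) j" if "i < j" for i j
    proof -
      have "e i < e j" using e that by (simp add: strict_mono_def)
      then have "B ^ Suc (e i) \<le> B ^ e j" using assms by (intro power_increasing) auto
      then show ?thesis by (simp add: w_def)
    qed
    fix k X Y assume *: "k \<le> n" "X \<subseteq> {..<n}" "Y \<subseteq> {..<n}" "card X = card Y"
    have "card (e ` Z) = card Z" for Z
      using e by (meson card_image inj_on_subset strict_mono_imp_inj_on subset_UNIV)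
    moreover have "finite X" "finite Y" "card Y \<le> n"
      using * by (auto intro: finite_subset simp: subset_eq_atLeast0_lessThan_card lessThan_atLeast0)
    ultimately show "mean_stop_prob (w \<circ> e) k X \<le> mean_stop_prob (w \<circ> e) k Y + \<delta>"
      using * osc[of k "card Y" "e ` X" "e ` Y"] eV by (simp add: mean_stop_prob_image[OF e])
  qed
qed

end

section \<open>The adversary's order\<close>

lemma last_sorted_list_of_set:
  fixes A :: "'a::linorder set"
  assumes "finite A" "A \<noteq> {}"
  shows "last (sorted_list_of_set A) = Max A"
proof -
  have "A = (A - {Max A}) \<union> {Max A}"
    using Max_in[OF assms] by auto
  moreover have "sorted_list_of_set ((A - {Max A}) \<union> {Max A}) = sorted_list_of_set (A - {Max A}) @ [Max A]"
    using assms by (subst sorted_list_of_set_Un_less) (auto simp: less_le)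
  ultimately show ?thesis by simp
qed

text \<open>
  The elements that arrive first. The parameter \<open>t\<close> only matters for the empty sample, where
  \<open>Max\<close> is undefined and the rank of the last element of the increasing run has to be hidden
  in another way.
\<close>

definition upper_part :: "nat \<Rightarrow> nat \<Rightarrow> nat set \<Rightarrow> nat set" where
  "upper_part n t S = (if S = {} then {n - t..<n} else {Max S<..<n})"

definition increasing_first :: "nat \<Rightarrow> nat \<Rightarrow> nat set \<Rightarrow> nat list" where
  "increasing_first n t S =
    sorted_list_of_set (upper_part n t S) @ sorted_list_of_set ({..<n} - S - upper_part n t S)"

lemma finite_upper_part [simp]: "finite (upper_part n t S)"
  unfolding upper_part_def by simp

lemma upper_part_subset: "upper_part n t S \<subseteq> {..<n}"
  unfolding upper_part_def by auto

lemma upper_part_greater: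
  assumes "finite S" "s \<in> S" "a \<in> upper_part n t S"
  shows "s < a"
  using assms unfolding upper_part_def by (auto split: if_splits intro: le_less_trans[OF Max_ge])

lemma increasing_first_permutation:
  assumes "S \<subseteq> {..<n}"
  shows "increasing_first n t S \<in> permutations_of_set ({..<n} - S)"
proof -
  have "finite S" using assms finite_subset by blast
  then show ?thesis
    using upper_part_subset[of n t S] upper_part_greater[of S _ _ n t] unfolding increasing_first_def
    by (intro permutations_of_setI) (auto dest: less_irrefl_nat)
qed

lemma adversarial_order_increasing_first: "adversarial_order n (increasing_first n t)"
  unfolding adversarial_order_def using increasing_first_permutation by blast

section \<open>Counting samples by the number of elements above them\<close>

text \<open>The maximum of \<open>S\<close> is determined by \<open>j\<close>, and removing it
  leaves a \<open>(k - 1)\<close>-subset of the numbers below \<open>n - 1 - j\<close>, which is at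
  most \<open>n - 2\<close>. So \<open>j = 1\<close> is the most likely positive number of elements
  beating the sample.\<close>

lemma card_subsets_Max_le:
  assumes "2 \<le> n" "1 \<le> k" "1 \<le> j"
  shows "card {S. S \<subseteq> {..<n} \<and> card S = k \<and> n - 1 - Max S = j} \<le> (n - 2) choose (k - 1)"
proof -
  let ?D = "{S. S \<subseteq> {..<n} \<and> card S = k \<and> n - 1 - Max S = j}"
  have D: "finite S" "Max S \<in> S" "Max S = n - 1 - j" "Max S \<le> n - 2" if "S \<in> ?D" for S
  proof -
    show "finite S" using that finite_subset by auto
    then show "Max S \<in> S" using that assms by (intro Max_in) auto
    then show "Max S = n - 1 - j" "Max S \<le> n - 2" using that assms by auto
  qed
  have "card ?D \<le> card {R. R \<subseteq> {..<n - 2} \<and> card R = k - 1}"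
  proof (rule card_inj_on_le)
    show "inj_on (\<lambda>S. S - {Max S}) ?D"
    proof (rule inj_onI)
      fix S S' assume S: "S \<in> ?D" "S' \<in> ?D" and eq: "S - {Max S} = S' - {Max S'}"
      have "insert (Max S) (S - {Max S}) = insert (Max S') (S' - {Max S'})"
        unfolding eq unfolding D(3)[OF S(1)] D(3)[OF S(2)] ..
      then show "S = S'"
        unfolding insert_Diff[OF D(2)[OF S(1)]] insert_Diff[OF D(2)[OF S(2)]] .
    qed
    show "(\<lambda>S. S - {Max S}) ` ?D \<subseteq> {R. R \<subseteq> {..<n - 2} \<and> card R = k - 1}"
    proof (rule image_subsetI)
      fix S assume S: "S \<in> ?D"
      have "x < Max S" if "x \<in> S - {Max S}" for x
        using that D(1)[OF S] Max_ge[of S x] by (auto simp: less_le)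
      then have "S - {Max S} \<subseteq> {..<n - 2}"
        using D(4)[OF S] by fastforce
      then show "S - {Max S} \<in> {R. R \<subseteq> {..<n - 2} \<and> card R = k - 1}"
        using S D(1,2)[OF S] by simp
    qed
  qed simp
  then show ?thesis by (simp add: n_subsets)
qed

text \<open>The quotient equals \<open>k (n - k) / (n (n - 1))\<close>, and \<open>k (n - k)\<close>
  is at most \<open>n * n / 4\<close> because the square of \<open>n - 2 k\<close> is
  non-negative.\<close>

lemma binomial_ratio_le:
  assumes "2 \<le> n" "1 \<le> k" "k \<le> n"
  shows "real ((n - 2) choose (k - 1)) / real (n choose k) \<le> real n / (4 * (real n - 1))"
proof -
  have "k * (n choose k) = n * ((n - 1) choose (k - 1))"
    using assms times_binomial_minus1_eq by auto
  moreover have "(n - k) * ((n - 1) choose (k - 1)) = (n - 1) * ((n - 2) choose (k - 1))"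
    using binomial_absorb_comp[of "n - 1" "k - 1"] assms by (simp add: numeral_2_eq_2)
  ultimately have "(n - k) * (k * (n choose k)) = n * ((n - 1) * ((n - 2) choose (k - 1)))"
    by (simp add: ac_simps)
  then have "real (n - k) * (real k * real (n choose k))
      = real n * (real (n - 1) * real ((n - 2) choose (k - 1)))"
    unfolding of_nat_mult[symmetric] by (rule arg_cong)
  then have eq: "(real n - real k) * real k * real (n choose k)
      = real n * (real n - 1) * real ((n - 2) choose (k - 1))"
    using assms by (simp add: of_nat_diff)
  have "0 < real n * (real n - 1)" "0 < real (n choose k)"
    using assms by auto
  with eq have "real ((n - 2) choose (k - 1)) / real (n choose k)
      = (real n - real k) * real k / (real n * (real n - 1))"
    using assms by (subst frac_eq_eq) (auto simp: ac_simps)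
  also have "\<dots> \<le> (real n * real n / 4) / (real n * (real n - 1))"
  proof (rule divide_right_mono)
    show "(real n - real k) * real k \<le> real n * real n / 4"
      using zero_le_square[of "real n - 2 * real k"] by (simp add: algebra_simps)
  qed (use assms in auto)
  also have "\<dots> = real n / (4 * (real n - 1))"
    using assms by (simp add: field_simps)
  finally show ?thesis .
qed

section \<open>The expected value against this order\<close>

context order_oblivious_algorithm
begin

text \<open>The top element is either sampled or the last of the initial increasing run. Winning it
  means stopping exactly there; everything else contributes at most the fraction \<eta> of the
  optimum. Averaging over the permutations then produces \<open>mean_stop_prob\<close> for uniformly
  random samples.\<close>

lemma expected_ALG_increasing_first_le:
  assumes n: "1 \<le> n" and t: "1 \<le> t" "t \<le> n"
    and v: "0 \<le> v (n - 1)" "0 \<le> \<eta>" "\<And>i. i < n - 1 \<Longrightarrow> v i \<le> \<eta> * v (n - 1)"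
  shows "expected_ALG M n sample_size accept v (increasing_first n t) \<le> v (n - 1) *
    ((\<Sum>k\<le>n. (\<Sum>S | S \<subseteq> {..<n} \<and> card S = k. mean_stop_prob v k (S \<union> upper_part n t S)) / (n choose k)) + \<eta>)"
proof -
  let ?P = "permutations_of_set {..<n}"
  \<comment> \<open>Only the sampled prefix enters, as \<open>sum_permutations_take\<close>
    requires.\<close>
  define F where "F k xs = stop_prob k (map v (xs @ sorted_list_of_set (upper_part n t (set xs))))" for k xs
  have pointwise: "(\<integral>\<omega>. accepted_value (sample_size \<omega>) (accept \<omega>)
        (map v (arrival_sequence (sample_size \<omega>) (increasing_first n t) p)) \<partial>M)
      \<le> v (n - 1) * ((\<Sum>k\<le>n. F k (take k p)) + \<eta>)" if p: "p \<in> ?P" for p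
  proof -
    define ys where "ys k = sorted_list_of_set (upper_part n t (set (take k p)))" for k
    define zs where "zs k = sorted_list_of_set ({..<n} - set (take k p) - upper_part n t (set (take k p)))" for k
    define E where "E k = {\<omega> \<in> space M. sample_size \<omega> = k \<and> stops_at k (accept \<omega>) (map v (take k p @ ys k))}" for k
    have [measurable]: "E k \<in> events" for k
      unfolding E_def by (rule stop_event)
    have setp: "set p = {..<n}" "distinct p" "length p = n"
      using p by (auto dest: permutations_of_setD length_finite_permutations_of_set)
    have sub: "set (take k p) \<subseteq> {..<n}" for k
      using setp set_take_subset by metis
    have arrival: "arrival_sequence k (increasing_first n t) p = take k p @ ys k @ zs k" for k
      unfolding arrival_sequence_def increasing_first_def ys_def zs_def by simp
    have bound: "accepted_value k acc (map v (take k p @ ys k @ zs k))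
        \<le> v (n - 1) * of_bool (stops_at k acc (map v (take k p @ ys k))) + \<eta> * v (n - 1)"
      if "k \<le> n" for k acc
    proof -
      have "accepted_value (length (take k p)) acc (map v (take k p @ ys k @ zs k))
        \<le> v (n - 1) * of_bool (stops_at (length (take k p)) acc (map v (take k p @ ys k))) + \<eta> * v (n - 1)"
      proof (rule accepted_value_le[where m = "n - 1"])
        have perm: "ys k @ zs k \<in> permutations_of_set ({..<n} - set (take k p))"
          using increasing_first_permutation[OF sub] unfolding increasing_first_def ys_def zs_def .
        then have set_yz: "set (ys k @ zs k) = {..<n} - set (take k p)"
          by (rule permutations_of_setD)
        show "distinct (take k p @ ys k @ zs k)"
          using set_yz permutations_of_setD(2)[OF perm] setp(2) by (auto simp: distinct_append)
        show "v x \<le> \<eta> * v (n - 1)" if "x \<in> set (ys k @ zs k)" "x \<noteq> n - 1" for x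
          using that unfolding set_yz by (intro v) auto
        have top: "n - 1 \<in> set (take k p) \<union> upper_part n t (set (take k p))"
        proof (cases "set (take k p) = {}")
          case True
          then show ?thesis using n t by (auto simp: upper_part_def)
        next
          case False
          then have mem: "Max (set (take k p)) \<in> set (take k p)" by (intro Max_in) auto
          then have "Max (set (take k p)) < n" using sub by blast
          then consider "Max (set (take k p)) = n - 1" | "Max (set (take k p)) < n - 1"
            by linarith
          then show ?thesis
          proof cases
            case 1
            then show ?thesis using mem by simp
          next
            case 2
            then have "n - 1 \<in> {Max (set (take k p))<..<n}" using n by simp
            then show ?thesis unfolding upper_part_def if_not_P[OF False] by blast
          qed
        qed
        then show "n - 1 \<notin> set (zs k)"
          unfolding zs_def by auto
        show "last (ys k) = n - 1" if "ys k \<noteq> []"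
        proof -
          have ne: "upper_part n t (set (take k p)) \<noteq> {}"
            using that unfolding ys_def by auto
          \<comment> \<open>A sampled \<open>n - 1\<close> would force every element of the upper
            part to exceed it.\<close>
          then have "n - 1 \<in> upper_part n t (set (take k p))"
            using upper_part_greater[of "set (take k p)" "n - 1" _ n t]
              upper_part_subset[of n t "set (take k p)"] top by fastforce
          then have "Max (upper_part n t (set (take k p))) = n - 1"
            using upper_part_subset[of n t "set (take k p)"] by (intro Max_eqI) auto
          then show ?thesis
            unfolding ys_def using ne by (simp add: last_sorted_list_of_set)
        qed
      qed (use v in auto)
      then show ?thesis using that setp(3) by simp
    qed
    have "(\<integral>\<omega>. accepted_value (sample_size \<omega>) (accept \<omega>)
        (map v (arrival_sequence (sample_size \<omega>) (increasing_first n t) p)) \<partial>M)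
      \<le> (\<integral>\<omega>. (\<Sum>k\<le>n. v (n - 1) * indicator (E k) \<omega>) + \<eta> * v (n - 1) \<partial>M)"
    \<comment> \<open>With a non-negative integrable bound, the left side needs no integrability
      proof: a non-integrable function has integral 0.\<close>
    proof (rule integral_mono')
      fix \<omega> assume w: "\<omega> \<in> space M"
      let ?k = "sample_size \<omega>"
      have "of_bool (stops_at ?k (accept \<omega>) (map v (take ?k p @ ys ?k))) = (indicator (E ?k) \<omega> :: real)"
        unfolding E_def indicator_def using w by simp
      then have "accepted_value ?k (accept \<omega>) (map v (take ?k p @ ys ?k @ zs ?k))
          \<le> v (n - 1) * indicator (E ?k) \<omega> + \<eta> * v (n - 1)"
        using bound[OF sample_size_le[OF w]] by metis
      also have "v (n - 1) * indicator (E ?k) \<omega> \<le> (\<Sum>k\<le>n. v (n - 1) * indicator (E k) \<omega>)"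
        using sample_size_le[OF w] v
        by (intro member_le_sum[where f = "\<lambda>k. v (n - 1) * indicator (E k) \<omega>"]) auto
      finally show "accepted_value ?k (accept \<omega>) (map v (arrival_sequence ?k (increasing_first n t) p))
          \<le> (\<Sum>k\<le>n. v (n - 1) * indicator (E k) \<omega>) + \<eta> * v (n - 1)"
        unfolding arrival by simp
      show "0 \<le> (\<Sum>k\<le>n. v (n - 1) * indicator (E k) \<omega>) + \<eta> * v (n - 1)"
        using v by (intro add_nonneg_nonneg sum_nonneg) auto
    next
      show "integrable M (\<lambda>\<omega>. (\<Sum>k\<le>n. v (n - 1) * indicator (E k) \<omega>) + \<eta> * v (n - 1))"
        by (intro Bochner_Integration.integrable_add Bochner_Integration.integrable_sum
            integrable_mult_right integrable_real_indicator) (auto simp: emeasure_eq_measure)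
    qed
    also have "\<dots> = (\<Sum>k\<le>n. \<integral>\<omega>. v (n - 1) * indicator (E k) \<omega> \<partial>M) + \<eta> * v (n - 1)"
      by (subst Bochner_Integration.integral_add,
          auto intro!: Bochner_Integration.integrable_sum integrable_mult_right integrable_real_indicator
            simp: emeasure_eq_measure prob_space simp del: sum_mult_indicator)
    also have "\<dots> = (\<Sum>k\<le>n. v (n - 1) * prob (E k)) + \<eta> * v (n - 1)"
      by simp
    also have "(\<Sum>k\<le>n. v (n - 1) * prob (E k)) = v (n - 1) * (\<Sum>k\<le>n. F k (take k p))"
      unfolding F_def stop_prob_def E_def ys_def by (simp add: sum_distrib_left)
    finally show ?thesis by (simp add: algebra_simps)
  qed
  have "expected_ALG M n sample_size accept v (increasing_first n t) =
      (\<Sum>p\<in>?P. \<integral>\<omega>. accepted_value (sample_size \<omega>) (accept \<omega>)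
        (map v (arrival_sequence (sample_size \<omega>) (increasing_first n t) p)) \<partial>M) / fact n"
    unfolding expected_ALG_def by (subst integral_pmf_of_set) auto
  also have "\<dots> \<le> (\<Sum>p\<in>?P. v (n - 1) * ((\<Sum>k\<le>n. F k (take k p)) + \<eta>)) / fact n"
    by (intro divide_right_mono sum_mono pointwise) auto
  also have "(\<Sum>p\<in>?P. v (n - 1) * ((\<Sum>k\<le>n. F k (take k p)) + \<eta>))
      = v (n - 1) * ((\<Sum>p\<in>?P. \<Sum>k\<le>n. F k (take k p)) + fact n * \<eta>)"
    unfolding sum_distrib_left[symmetric] sum.distrib by simp
  also have "(\<Sum>p\<in>?P. \<Sum>k\<le>n. F k (take k p)) = (\<Sum>k\<le>n. \<Sum>p\<in>?P. F k (take k p))"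
    by (rule sum.swap)
  also have "v (n - 1) * ((\<Sum>k\<le>n. \<Sum>p\<in>?P. F k (take k p)) + fact n * \<eta>) / fact n
      = v (n - 1) * ((\<Sum>k\<le>n. (\<Sum>p\<in>?P. F k (take k p)) / fact n) + \<eta>)"
    unfolding sum_divide_distrib[symmetric] by (simp add: field_simps)
  also have "(\<Sum>k\<le>n. (\<Sum>p\<in>?P. F k (take k p)) / fact n) = (\<Sum>k\<le>n.
      (\<Sum>S | S \<subseteq> {..<n} \<and> card S = k. mean_stop_prob v k (S \<union> upper_part n t S)) / (n choose k))"
  proof (rule sum.cong)
    fix k assume "k \<in> {..n}"
    then have "(\<Sum>p\<in>?P. F k (take k p)) / fact n =
       (\<Sum>S | S \<subseteq> {..<n} \<and> card S = k. (\<Sum>xs\<in>permutations_of_set S. F k xs) / fact k) / (n choose k)"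
      using sum_permutations_take[of "{..<n}" k "F k"] by simp
    also have "(\<Sum>S | S \<subseteq> {..<n} \<and> card S = k. (\<Sum>xs\<in>permutations_of_set S. F k xs) / fact k) =
       (\<Sum>S | S \<subseteq> {..<n} \<and> card S = k. mean_stop_prob v k (S \<union> upper_part n t S))"
    proof (rule sum.cong)
      fix S assume "S \<in> {S. S \<subseteq> {..<n} \<and> card S = k}"
      then have S: "finite S" "card S = k" by (auto intro: finite_subset)
      have "(\<Sum>xs\<in>permutations_of_set S. F k xs) =
        (\<Sum>xs\<in>permutations_of_set S. stop_prob k (map v (xs @ sorted_list_of_set (upper_part n t S))))"
        unfolding F_def by (intro sum.cong) (auto dest: permutations_of_setD)
      then show "(\<Sum>xs\<in>permutations_of_set S. F k xs) / fact k = mean_stop_prob v k (S \<union> upper_part n t S)"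
        using S upper_part_greater by (subst mean_stop_prob_Un) auto
    qed simp
    finally show "(\<Sum>p\<in>?P. F k (take k p)) / fact n =
      (\<Sum>S | S \<subseteq> {..<n} \<and> card S = k. mean_stop_prob v k (S \<union> upper_part n t S)) / (n choose k)" .
  qed simp
  finally show ?thesis .
qed

section \<open>Winning probabilities for non-empty and for empty samples\<close>

text \<open>Samples are grouped by the number \<open>j\<close> of elements above their maximum. Up
  to \<delta>, the stopping probability depends only on \<open>k\<close> and \<open>j\<close>, so
  initial segments may stand in for the actual sets. Each group with \<open>j \<ge> 1\<close> has at
  most \<open>(n - 2) choose (k - 1)\<close> members, and the stopping probabilities summed over
  \<open>j\<close> stay below \<open>size_prob k\<close>.\<close>

lemma sample_average_le:
  assumes "2 \<le> n" "1 \<le> k" "k \<le> n"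
    and osc: "\<And>X Y. \<lbrakk>X \<subseteq> {..<n}; Y \<subseteq> {..<n}; card X = card Y\<rbrakk>
      \<Longrightarrow> mean_stop_prob v k X \<le> mean_stop_prob v k Y + \<delta>"
  shows "(\<Sum>S | S \<subseteq> {..<n} \<and> card S = k. mean_stop_prob v k (S \<union> upper_part n t S)) / (n choose k)
    \<le> real n / (4 * (real n - 1)) * size_prob k + \<delta>"
proof -
  let ?T = "{S. S \<subseteq> {..<n} \<and> card S = k}"
  \<comment> \<open>For \<open>j = 0\<close> the maximum has been sampled and cannot be won; the
    large group of such samples must not be counted.\<close>
  define G where "G j = (if j = 0 then 0 else mean_stop_prob v k {..<k + j})" for j
  have G_nonneg: "0 \<le> G j" for j
    unfolding G_def using mean_stop_prob_bounds[of v k "{..<k + j}"] by simp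
  have \<delta>: "0 \<le> \<delta>" using osc[of "{}" "{}"] by simp
  have finT: "finite ?T" by simp
  have T: "finite S" "card S = k" "Max S < n" "n - 1 - Max S \<le> n - k" "S \<noteq> {}" if "S \<in> ?T" for S
  proof -
    show S: "finite S" "card S = k" "S \<noteq> {}" using that assms finite_subset by auto
    show "Max S < n" using Max_in[OF S(1,3)] that by auto
    have "S \<subseteq> {..Max S}" using S by auto
    then have "card S \<le> card {..Max S}" by (intro card_mono) auto
    then have "k \<le> Suc (Max S)" using S by simp
    then show "n - 1 - Max S \<le> n - k" by linarith
  qed
  have "mean_stop_prob v k (S \<union> upper_part n t S) \<le> G (n - 1 - Max S) + \<delta>" if "S \<in> ?T" for S
  proof (cases "n - 1 - Max S = 0")
    case True
    then have "upper_part n t S = {}" using T[OF that] by (auto simp: upper_part_def)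
    then have "mean_stop_prob v k (S \<union> upper_part n t S) = 0"
      using mean_stop_prob_Un[of S "{}" k v] T[OF that]
      by (simp add: stop_prob_sample length_finite_permutations_of_set)
    then show ?thesis using \<delta> G_nonneg by simp
  next
    case False
    have "card (S \<union> upper_part n t S) = card S + card (upper_part n t S)"
      using T[OF that] upper_part_greater[of S _ _ n t] by (intro card_Un_disjoint) fastforce+
    also have "\<dots> = k + (n - 1 - Max S)"
      using T[OF that] by (simp add: upper_part_def)
    finally have "card (S \<union> upper_part n t S) = card {..<k + (n - 1 - Max S)}"
      by simp
    moreover have "k + (n - 1 - Max S) \<le> n"
      using T(4)[OF that] assms(3) by linarith
    ultimately have "mean_stop_prob v k (S \<union> upper_part n t S) \<le> mean_stop_prob v k {..<k + (n - 1 - Max S)} + \<delta>"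
      using that upper_part_subset[of n t S] by (intro osc) auto
    then show ?thesis using False by (simp add: G_def)
  qed
  then have "(\<Sum>S\<in>?T. mean_stop_prob v k (S \<union> upper_part n t S)) \<le> (\<Sum>S\<in>?T. G (n - 1 - Max S) + \<delta>)"
    by (rule sum_mono)
  also have "\<dots> = (\<Sum>S\<in>?T. G (n - 1 - Max S)) + (n choose k) * \<delta>"
    by (simp add: sum.distrib n_subsets)
  also have "(\<Sum>S\<in>?T. G (n - 1 - Max S)) = (\<Sum>j\<le>n - k. \<Sum>S | S \<in> ?T \<and> n - 1 - Max S = j. G (n - 1 - Max S))"
    by (rule sum.group[symmetric]) (use T(4) finT in auto)
  also have "\<dots> = (\<Sum>j\<le>n - k. card {S. S \<subseteq> {..<n} \<and> card S = k \<and> n - 1 - Max S = j} * G j)"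
    by (intro sum.cong) (simp_all add: conj_assoc)
  also have "\<dots> \<le> (\<Sum>j\<le>n - k. ((n - 2) choose (k - 1)) * mean_stop_prob v k {..<k + j})"
  proof (rule sum_mono)
    fix j
    show "card {S. S \<subseteq> {..<n} \<and> card S = k \<and> n - 1 - Max S = j} * G j
        \<le> ((n - 2) choose (k - 1)) * mean_stop_prob v k {..<k + j}"
    proof (cases "j = 0")
      case True
      then show ?thesis using mean_stop_prob_bounds[of v k "{..<k + j}"] by (simp add: G_def)
    next
      case False
      then show ?thesis
        using card_subsets_Max_le[OF assms(1,2), of j] mean_stop_prob_bounds[of v k "{..<k + j}"]
        by (auto simp: G_def intro!: mult_right_mono)
    qed
  qed
  also have "\<dots> \<le> ((n - 2) choose (k - 1)) * size_prob k"
    unfolding sum_distrib_left[symmetric]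
    by (intro mult_left_mono sum_mean_stop_prob_le assms) simp
  finally have "(\<Sum>S\<in>?T. mean_stop_prob v k (S \<union> upper_part n t S)) / (n choose k)
      \<le> (((n - 2) choose (k - 1)) * size_prob k + (n choose k) * \<delta>) / (n choose k)"
    by (simp add: divide_right_mono)
  also have "\<dots> = ((n - 2) choose (k - 1)) / (n choose k) * size_prob k + \<delta>"
    using assms by (simp add: add_divide_distrib)
  also have "\<dots> \<le> real n / (4 * (real n - 1)) * size_prob k + \<delta>"
    using binomial_ratio_le[OF assms(1-3)] by (intro add_right_mono mult_right_mono) (auto simp: size_prob_def)
  finally show ?thesis .
qed

text \<open>The top \<open>t\<close> elements look, up to \<delta>, like the lowest
  \<open>t\<close>, and the runs of the lowest \<open>t\<close> are prefixes of one sequence. The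
  algorithm thus has to divide its stopping probability among the \<open>n\<close> values of
  \<open>t\<close>.\<close>

lemma empty_sample_average_le:
  fixes \<delta> :: real
  assumes osc: "\<And>X Y. \<lbrakk>X \<subseteq> {..<n}; Y \<subseteq> {..<n}; card X = card Y\<rbrakk>
      \<Longrightarrow> mean_stop_prob v 0 X \<le> mean_stop_prob v 0 Y + \<delta>"
  shows "(\<Sum>t = 1..n. mean_stop_prob v 0 {n - t..<n}) \<le> size_prob 0 + n * \<delta>"
proof -
  have "(\<Sum>t = 1..n. mean_stop_prob v 0 {n - t..<n}) \<le> (\<Sum>t = 1..n. mean_stop_prob v 0 {..<t} + \<delta>)"
    by (intro sum_mono osc) auto
  also have "\<dots> = (\<Sum>t = 1..n. mean_stop_prob v 0 {..<t}) + n * \<delta>"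
    by (simp add: sum.distrib)
  also have "(\<Sum>t = 1..n. mean_stop_prob v 0 {..<t}) \<le> (\<Sum>t\<le>n. mean_stop_prob v 0 {..<t})"
    using mean_stop_prob_bounds[of v 0] by (intro sum_mono2) auto
  also have "\<dots> \<le> size_prob 0"
    using sum_mean_stop_prob_le[of 0 n v] by simp
  finally show ?thesis by simp
qed

section \<open>Combining the bounds\<close>

text \<open>Every \<open>t\<close> gives a bound on \<open>c\<close> in which only the empty-sample
  term varies with \<open>t\<close>. Averaging over \<open>t\<close> leaves
  \<open>p / n + \<alpha> * (1 - p)\<close> with \<open>p = size_prob 0\<close>, plus an error
  \<epsilon> for each of the \<open>n\<close> positive sample sizes, one for the empty sample and
  one for the worthless elements.\<close>

lemma competitive_ratio_le_eps:
  fixes \<epsilon> :: real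
  assumes n: "2 \<le> n" and comp: "order_oblivious_competitive M n sample_size accept c" and \<epsilon>: "0 < \<epsilon>"
  shows "c \<le> 1 / 4 * (1 + 5 / (real n - 1)) + (real n + 2) * \<epsilon>"
proof -
  define B where "B = 1 + 1 / \<epsilon>"
  have B: "1 \<le> B" "1 / B \<le> \<epsilon>"
    using \<epsilon> unfolding B_def by (auto simp: field_simps)
  obtain v where pos: "\<And>i. 0 < v i" and gap: "\<And>i j. i < j \<Longrightarrow> B * v i \<le> v j"
    and osc: "\<And>k X Y. \<lbrakk>k \<le> n; X \<subseteq> {..<n}; Y \<subseteq> {..<n}; card X = card Y\<rbrakk>
      \<Longrightarrow> mean_stop_prob v k X \<le> mean_stop_prob v k Y + \<epsilon>"
    using exists_indistinguishable_values[OF B(1) \<epsilon>] by metis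
  define \<alpha> where "\<alpha> = real n / (4 * (real n - 1))"
  define \<beta> where "\<beta> = 1 / 4 * (1 + 5 / (real n - 1))"
  have opt: "OPT n v = v (n - 1)"
    unfolding OPT_def
  proof (rule Max_eqI)
    fix y assume "y \<in> v ` {..<n}"
    then obtain i where i: "y = v i" "i < n" by auto
    show "y \<le> v (n - 1)"
    proof (cases "i = n - 1")
      case False
      have "1 * v i \<le> B * v i" using B pos[of i] by (intro mult_right_mono) auto
      moreover have "B * v i \<le> v (n - 1)" using i False by (intro gap) linarith
      ultimately show ?thesis using i by simp
    qed (use i in simp)
  qed (use n in auto)
  have small: "v i \<le> 1 / B * v (n - 1)" if "i < n - 1" for i
    using gap[OF that] B by (simp add: field_simps)
  have t_bound: "c \<le> mean_stop_prob v 0 {n - t..<n} + (\<Sum>k = 1..n. \<alpha> * size_prob k + \<epsilon>) + \<epsilon>"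
    if t: "t \<in> {1..n}" for t
  proof -
    let ?avg = "\<lambda>k. (\<Sum>S | S \<subseteq> {..<n} \<and> card S = k. mean_stop_prob v k (S \<union> upper_part n t S)) / (n choose k)"
    have "c * OPT n v \<le> expected_ALG M n sample_size accept v (increasing_first n t)"
      using comp adversarial_order_increasing_first pos
      unfolding order_oblivious_competitive_def by (meson less_imp_le)
    also have "\<dots> \<le> v (n - 1) * ((\<Sum>k\<le>n. ?avg k) + 1 / B)"
      using t n B pos[of "n - 1"] small by (intro expected_ALG_increasing_first_le) auto
    finally have "c \<le> (\<Sum>k\<le>n. ?avg k) + 1 / B"
      unfolding opt using pos[of "n - 1"] by (simp add: mult.commute)
    also have "(\<Sum>k\<le>n. ?avg k) = ?avg 0 + (\<Sum>k = 1..n. ?avg k)"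
      by (simp add: atMost_atLeast0 sum.atLeast_Suc_atMost)
    also have "?avg 0 = mean_stop_prob v 0 {n - t..<n}"
    proof -
      have "{S. S \<subseteq> {..<n} \<and> card S = 0} = {{}}"
        by (auto dest: finite_subset)
      then show ?thesis by (simp add: upper_part_def)
    qed
    also have "(\<Sum>k = 1..n. ?avg k) \<le> (\<Sum>k = 1..n. \<alpha> * size_prob k + \<epsilon>)"
      unfolding \<alpha>_def using n osc by (intro sum_mono sample_average_le) auto
    finally show ?thesis using B by simp
  qed
  define p where "p = size_prob 0"
  have p: "0 \<le> p" "p \<le> 1" unfolding p_def size_prob_def by auto
  have rest: "(\<Sum>k = 1..n. size_prob k) = 1 - p"
    using sum_size_prob by (simp add: p_def atMost_atLeast0 sum.atLeast_Suc_atMost)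
  have "(\<Sum>t = 1..n. c) \<le> (\<Sum>t = 1..n. mean_stop_prob v 0 {n - t..<n} + (\<Sum>k = 1..n. \<alpha> * size_prob k + \<epsilon>) + \<epsilon>)"
    by (intro sum_mono t_bound)
  also have "\<dots> = (\<Sum>t = 1..n. mean_stop_prob v 0 {n - t..<n}) + n * (\<alpha> * (1 - p) + n * \<epsilon> + \<epsilon>)"
    unfolding sum.distrib sum_distrib_left[symmetric] rest by (simp add: algebra_simps)
  finally have "n * c \<le> (\<Sum>t = 1..n. mean_stop_prob v 0 {n - t..<n}) + n * (\<alpha> * (1 - p) + n * \<epsilon> + \<epsilon>)"
    by simp
  also have "(\<Sum>t = 1..n. mean_stop_prob v 0 {n - t..<n}) \<le> p + n * \<epsilon>"
    unfolding p_def by (intro empty_sample_average_le osc) auto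
  finally have main: "n * c \<le> p + n * (\<alpha> * (1 - p) + n * \<epsilon> + 2 * \<epsilon>)"
    by (simp add: algebra_simps)
  \<comment> \<open>Here \<alpha> is \<open>1/4 * (1 + 1/(n - 1))\<close>; the second inequality
    amounts to \<open>n * (n + 4) \<ge> 4 * (n - 1)\<close>. So \<beta> bounds the winning
    probability for both kinds of sample.\<close>
  have "\<alpha> \<le> \<beta>" "1 \<le> n * \<beta>"
    using n unfolding \<alpha>_def \<beta>_def by (auto simp: field_simps)
  then have "p * 1 \<le> p * (n * \<beta>)" "n * (\<alpha> * (1 - p)) \<le> n * (\<beta> * (1 - p))"
    using p by (intro mult_left_mono mult_right_mono; simp)+
  with main have "n * c \<le> n * (\<beta> + (real n + 2) * \<epsilon>)"
    by (simp add: algebra_simps)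
  then show ?thesis
    using n unfolding \<beta>_def by simp
qed

end

theorem theorem2p9:
  fixes M :: "'w measure" and n :: nat
    and sample_size :: "'w \<Rightarrow> nat" and accept :: "'w \<Rightarrow> real list \<Rightarrow> bool"
    and c :: real
  assumes "n \<ge> 2"
    and "order_oblivious_algorithm M n sample_size accept"
    and "order_oblivious_competitive M n sample_size accept c"
  shows "c \<le> 1 / 4 * (1 + 5 / (real n - 1)) \<and>
    (\<lambda>m::nat. 1 / 4 * (1 + 5 / (real m - 1)) - 1 / 4) \<in> o(\<lambda>_. 1)"
proof
  show "c \<le> 1 / 4 * (1 + 5 / (real n - 1))"
  proof (rule field_le_epsilon)
    \<comment> \<open>The adversary's values depend on the permitted error, so the bound is reached
      as a limit; dividing by \<open>n + 2\<close> absorbs the accumulated errors.\<close>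
    fix e :: real assume "0 < e"
    then have "0 < e / (real n + 2)" by simp
    from order_oblivious_algorithm.competitive_ratio_le_eps[OF assms(2,1,3) this]
    show "c \<le> 1 / 4 * (1 + 5 / (real n - 1)) + e"
      by (simp add: add_pos_nonneg)
  qed
  show "(\<lambda>m::nat. 1 / 4 * (1 + 5 / (real m - 1)) - 1 / 4) \<in> o(\<lambda>_. 1)"
    by real_asymp
qed

end
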